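(* Consider the trading prophets problem (defined in the context) with independent prices $X_i \sim D_i$, $i=1,\dots,T$, in arbitrary (adversarial) order. The Buy Low Sell High algorithm is $3$-competitive. Moreover, if $\mathbb{E}[X_i]=\mu$ for all $i=1,\ldots,T$, then the Buy Low Sell High algorithm is $2$-competitive. These competitive ratios are best possible, i.e.\ no online algorithm achieves a smaller competitive ratio in the respective setting.
   Context: Trading prophets problem: let $T\ge 1$ be an integer. Prices $X_1,\dots,X_T$ are independent non-negative real random variables, $X_i\sim D_i$, where the distributions $D_i$ are known to the trader; in addition set $X_0=X_{T+1}=0$ deterministically, and write $\mu_i=\mathbb{E}[X_i]$ for $i\in\{0,\dots,T+1\}$. At each time $i=0,1,\dots,T+1$ the price $X_i$ is revealed and the trader, who may hold at most one unit of the stock at any time, may buy one unit at price $X_i$ (if not holding) or sell its unit at price $X_i$ (if holding). (Since $X_0=0$, this is equivalent to both trader and prophet starting with one unit of stock.) If $B\subseteq\{0,\dots,T+1\}$ and $S\subseteq\{1,\dots,T+1\}$ are the times of purchases and sales, the profit is $\sum_{i\in S}X_i-\sum_{i\in B}X_i$. An online algorithm makes its decision at time $i$ based only on the distributions, the realizations $X_0,\dots,X_i$, and possibly internal randomness; $\mathrm{ALG}$ denotes its profit. $\mathrm{OPT}$ denotes the maximum profit achievable (under the same one-unit holding constraint) by an offline prophet who knows all realizations $X_1,\dots,X_T$ in advance. An algorithm is $\alpha$-competitive if $\mathbb{E}[\mathrm{OPT}]\le \alpha\cdot\mathbb{E}[\mathrm{ALG}]+c$ for a constant $c$ independent of $T$.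 Buy Low Sell High algorithm: for each $i=0,1,\dots,T$, after observing $X_i$: if it holds the stock and $X_i>\mathbb{E}[X_{i+1}]$, it sells; if it does not hold the stock and $X_i\le \mathbb{E}[X_{i+1}]$, it buys. *)

theory Defs
  imports "HOL-Probability.Probability"
begin

text \<open>
  A market is the list \<open>[D\<^sub>1, \<dots>, D\<^sub>T]\<close> of the price distributions, in the order in which
  the prices are revealed; thus \<open>T\<close> is the length of the list.
\<close>

type_synonym market = "real measure list"

definition valid_market :: "market \<Rightarrow> bool" where
  "valid_market D \<longleftrightarrow> D \<noteq> [] \<and>
     (\<forall>M\<in>set D. prob_space M \<and> sets M = sets borel \<and> (AE x in M. 0 \<le> x) \<and> integrable M (\<lambda>x. x))"

text \<open>The distribution of \<open>X\<^sub>i\<close>; outside \<open>{1..T}\<close>, in particular for \<open>i = 0\<close> and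
  \<open>i = T + 1\<close>, this is the point mass at 0.\<close>

definition price_dist :: "market \<Rightarrow> nat \<Rightarrow> real measure" where
  "price_dist D i = (if i \<in> {1..length D} then D ! (i - 1) else return borel 0)"

definition mean_price :: "market \<Rightarrow> nat \<Rightarrow> real" where
  "mean_price D i = (\<integral>x. x \<partial>price_dist D i)"

definition joint_law :: "market \<Rightarrow> (nat \<Rightarrow> real) measure" where
  "joint_law D = PiM {0..length D + 1} (price_dist D)"

definition profit :: "(nat \<Rightarrow> real) \<Rightarrow> nat set \<Rightarrow> nat set \<Rightarrow> real" where
  "profit x B S = (\<Sum>i\<in>S. x i) - (\<Sum>i\<in>B. x i)"

definition stock_after :: "nat set \<Rightarrow> nat set \<Rightarrow> nat \<Rightarrow> int" where
  "stock_after B S t = int (card (B \<inter> {..t})) - int (card (S \<inter> {..t}))"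

definition feasible :: "nat \<Rightarrow> nat set \<Rightarrow> nat set \<Rightarrow> bool" where
  "feasible T B S \<longleftrightarrow> B \<subseteq> {0..T+1} \<and> S \<subseteq> {1..T+1} \<and> B \<inter> S = {} \<and>
     (\<forall>t\<in>{0..T+1}. stock_after B S t \<in> {0, 1})"

definition opt :: "nat \<Rightarrow> (nat \<Rightarrow> real) \<Rightarrow> real" where
  "opt T x = Max {profit x B S | B S. feasible T B S}"

definition expected_opt :: "market \<Rightarrow> real" where
  "expected_opt D = (\<integral>x. opt (length D) x \<partial>joint_law D)"

text \<open>
  A strategy draws a random seed \<open>r\<close> once, independently of the prices (this is all of its
  internal randomness).  \<open>trade s i h r x\<close> tells whether it trades at time \<open>i\<close>, where \<open>h\<close>
  tells whether it currently holds the stock: a trade is then a sale if \<open>h\<close> holds and a purchase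
  otherwise.  It is only ever applied to a price sequence \<open>x\<close> restricted to the times
  \<open>0, \<dots>, i\<close>, so it cannot depend on later prices.
\<close>

record 'r strategy =
  seed :: "'r measure"
  trade :: "nat \<Rightarrow> bool \<Rightarrow> 'r \<Rightarrow> (nat \<Rightarrow> real) \<Rightarrow> bool"

primrec holding :: "'r strategy \<Rightarrow> 'r \<Rightarrow> (nat \<Rightarrow> real) \<Rightarrow> nat \<Rightarrow> bool" where
  "holding s r x 0 = False"
| "holding s r x (Suc i) =
     (if trade s i (holding s r x i) r (restrict x {0..i})
      then \<not> holding s r x i else holding s r x i)"

definition buy_times :: "'r strategy \<Rightarrow> nat \<Rightarrow> 'r \<Rightarrow> (nat \<Rightarrow> real) \<Rightarrow> nat set" where
  "buy_times s T r x =
     {i\<in>{0..T+1}. \<not> holding s r x i \<and> trade s i False r (restrict x {0..i})}"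

definition sell_times :: "'r strategy \<Rightarrow> nat \<Rightarrow> 'r \<Rightarrow> (nat \<Rightarrow> real) \<Rightarrow> nat set" where
  "sell_times s T r x =
     {i\<in>{0..T+1}. holding s r x i \<and> trade s i True r (restrict x {0..i})}"

type_synonym 'r algorithm = "market \<Rightarrow> 'r strategy"

definition expected_alg :: "'r algorithm \<Rightarrow> market \<Rightarrow> real" where
  "expected_alg A D =
     (\<integral>(r, x). profit x (buy_times (A D) (length D) r x) (sell_times (A D) (length D) r x)
        \<partial>(seed (A D) \<Otimes>\<^sub>M joint_law D))"

text \<open>Apart from the shape of \<^typ>\<open>'r strategy\<close>, being an online algorithm on a class of markets
  only means that the decisions are random variables, so that the expected profit makes sense.\<close>

definition online_algorithm :: "market set \<Rightarrow> 'r algorithm \<Rightarrow> bool" where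
  "online_algorithm C A \<longleftrightarrow> (\<forall>D\<in>C. prob_space (seed (A D)) \<and>
     (\<forall>i\<in>{0..length D + 1}. \<forall>h.
        Measurable.pred (seed (A D) \<Otimes>\<^sub>M PiM {0..i} (\<lambda>_. borel)) (\<lambda>(r, x). trade (A D) i h r x)))"

definition competitive :: "market set \<Rightarrow> 'r algorithm \<Rightarrow> real \<Rightarrow> bool" where
  "competitive C A \<alpha> \<longleftrightarrow> (\<exists>c. \<forall>D\<in>C. expected_opt D \<le> \<alpha> * expected_alg A D + c)"

definition all_markets :: "market set" where
  "all_markets = {D. valid_market D}"

definition equal_mean_markets :: "real \<Rightarrow> market set" where
  "equal_mean_markets \<mu> = {D. valid_market D \<and> (\<forall>i\<in>{1..length D}. mean_price D i = \<mu>)}"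

definition buy_low_sell_high :: "unit algorithm" where
  "buy_low_sell_high D =
     \<lparr>seed = return (count_space UNIV) (),
      trade = (\<lambda>i h _ x. i \<le> length D \<and>
        (if h then x i > mean_price D (i + 1) else x i \<le> mean_price D (i + 1)))\<rparr>"

lemma online_algorithm_buy_low_sell_high: "online_algorithm C buy_low_sell_high"
  unfolding online_algorithm_def
proof (intro ballI conjI allI)
  fix D :: market assume "D \<in> C"
  show "prob_space (seed (buy_low_sell_high D))"
    by (simp add: buy_low_sell_high_def prob_space_return)
next
  fix D :: market and i h
  assume "i \<in> {0..length D + 1}"
  show "Measurable.pred (seed (buy_low_sell_high D) \<Otimes>\<^sub>M PiM {0..i} (\<lambda>_. borel))
          (\<lambda>(r, x). trade (buy_low_sell_high D) i h r x)"
    unfolding buy_low_sell_high_def by (cases h) (simp_all add: split_beta)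
qed

lemma feasible_trades: "feasible T (buy_times s T r x) (sell_times s T r x)"
proof -
  let ?B = "buy_times s T r x" and ?S = "sell_times s T r x"
  have stock: "stock_after ?B ?S t = of_bool (holding s r x (Suc t))" if "t \<le> T + 1" for t
    using that
  proof (induction t)
    case 0
    have "?B \<inter> {..0} = (if holding s r x (Suc 0) then {0} else {})" "?S \<inter> {..0} = {}"
      by (auto simp: buy_times_def sell_times_def)
    then show ?case by (simp add: stock_after_def)
  next
    case (Suc t)
    have fin: "finite ?B" "finite ?S"
      by (auto simp: buy_times_def sell_times_def)
    have "?B \<inter> {..Suc t} = (if Suc t \<in> ?B then insert (Suc t) (?B \<inter> {..t}) else ?B \<inter> {..t})"
         "?S \<inter> {..Suc t} = (if Suc t \<in> ?S then insert (Suc t) (?S \<inter> {..t}) else ?S \<inter> {..t})"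
      by (auto simp: le_Suc_eq)
    then have "stock_after ?B ?S (Suc t) =
        stock_after ?B ?S t + of_bool (Suc t \<in> ?B) - of_bool (Suc t \<in> ?S)"
      using fin by (simp add: stock_after_def)
    moreover have "stock_after ?B ?S t = of_bool (holding s r x (Suc t))"
      using Suc by simp
    moreover have "Suc t \<in> ?B \<longleftrightarrow> \<not> holding s r x (Suc t) \<and> holding s r x (Suc (Suc t))"
      "Suc t \<in> ?S \<longleftrightarrow> holding s r x (Suc t) \<and> \<not> holding s r x (Suc (Suc t))"
      using Suc.prems by (auto simp: buy_times_def sell_times_def simp del: holding.simps(2)
          simp: holding.simps(2)[of s r x "Suc t"])
    ultimately show ?case by (auto simp del: holding.simps(2))
  qed
  have "?S \<subseteq> {1..T+1}"
  proof
    fix i assume i: "i \<in> ?S"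
    then have "i \<noteq> 0" by (intro notI) (simp add: sell_times_def)
    then show "i \<in> {1..T+1}" using i by (auto simp: sell_times_def)
  qed
  moreover have "stock_after ?B ?S t \<in> {0, 1}" if "t \<in> {0..T+1}" for t
    using stock[of t] that by (simp del: holding.simps(2))
  moreover have "?B \<subseteq> {0..T+1}" "?B \<inter> ?S = {}"
    by (auto simp: buy_times_def sell_times_def)
  ultimately show ?thesis by (simp add: feasible_def)
qed

end

theory Submission
  imports Defs
begin

text \<open>
  Both players' profits telescope over the periods in which the stock is held. The prophet collects
  every rise \<open>(X\<^sub>i\<^sub>+\<^sub>1 - X\<^sub>i)\<^sup>+\<close>. An online trader's decision at time \<open>i\<close> is
  independent of \<open>X\<^sub>i\<^sub>+\<^sub>1\<close>, so period \<open>i\<close> is worth at most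
  \<open>G\<^sub>i = E (\<mu>\<^sub>i\<^sub>+\<^sub>1 - X\<^sub>i)\<^sup>+\<close>, which Buy Low Sell High attains.

  For the upper bounds, split a rise at \<open>\<mu>\<^sub>i\<^sub>+\<^sub>1\<close>: the lower part contributes \<open>G\<^sub>i\<close>, the
  upper part \<open>E (X\<^sub>i\<^sub>+\<^sub>1 - \<mu>\<^sub>i\<^sub>+\<^sub>1)\<^sup>+ = E (\<mu>\<^sub>i\<^sub>+\<^sub>1 - X\<^sub>i\<^sub>+\<^sub>1)\<^sup>+ \<le>
  G\<^sub>i\<^sub>+\<^sub>1 + (\<mu>\<^sub>i\<^sub>+\<^sub>1 - \<mu>\<^sub>i\<^sub>+\<^sub>2)\<^sup>+\<close>. The falls of the means add up to at most a
  third copy of \<open>\<Sum>i. G\<^sub>i\<close>; for equal means only the final fall \<open>\<mu>\<close> remains, and it is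
  paid for by \<open>G\<^sub>0 = \<mu>\<close>.

  For the lower bounds, let two distributions alternate, so that all of these estimates are
  (asymptotically) tight in every period.
\<close>

section \<open>Profits of trading schedules\<close>

text \<open>Summation by parts: \<open>h i - h (Suc i)\<close> is the signed trade at time
  \<open>i\<close> and \<open>h (Suc i)\<close> the stock carried through the following period, so
  cash flows turn into price increments.\<close>

lemma sum_diff_mult_by_parts:
  fixes h x :: "nat \<Rightarrow> real"
  assumes "h 0 = 0"
  shows "(\<Sum>i\<le>n. (h i - h (Suc i)) * x i)
    = (\<Sum>i<n. h (Suc i) * (x (Suc i) - x i)) - h (Suc n) * x n"
  by (induction n) (auto simp: assms algebra_simps)

lemma profit_eq_sum_holdings:
  fixes h :: "nat \<Rightarrow> real"
  assumes "B \<subseteq> {0..T+1}" "S \<subseteq> {0..T+1}" "h 0 = 0"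
    and h: "\<And>i. i \<le> T + 1 \<Longrightarrow> h (Suc i) = h i + of_bool (i \<in> B) - of_bool (i \<in> S)"
  shows "profit x B S = (\<Sum>i\<le>T. h (Suc i) * (x (Suc i) - x i)) - h (T + 2) * x (T + 1)"
proof -
  have sum_eq: "(\<Sum>i\<in>A. x i) = (\<Sum>i\<le>T+1. of_bool (i \<in> A) * x i)" if "A \<subseteq> {0..T+1}" for A
  proof -
    have "{..T+1} \<inter> A = A" using that by auto
    then show ?thesis
      by (simp add: sum.inter_restrict[symmetric] of_bool_def if_distrib[of "\<lambda>t. t * _"] cong: if_cong
          del: sum.atMost_Suc)
  qed
  have "profit x B S = (\<Sum>i\<le>T+1. (of_bool (i \<in> S) - of_bool (i \<in> B)) * x i)"
    unfolding profit_def sum_eq[OF assms(1)] sum_eq[OF assms(2)]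
    by (simp add: sum_subtractf left_diff_distrib del: sum.atMost_Suc)
  also have "\<dots> = (\<Sum>i\<le>T+1. (h i - h (Suc i)) * x i)"
    using h by (intro sum.cong) (auto simp del: sum.atMost_Suc)
  also have "\<dots> = (\<Sum>i<T+1. h (Suc i) * (x (Suc i) - x i)) - h (Suc (T + 1)) * x (T + 1)"
    by (rule sum_diff_mult_by_parts) (rule assms(3))
  finally show ?thesis
    by (simp only: Suc_eq_plus1[symmetric] lessThan_Suc_atMost add_2_eq_Suc')
qed

lemma profit_strategy:
  "profit x (buy_times s T r y) (sell_times s T r y)
    = (\<Sum>i\<le>T. of_bool (holding s r y (Suc i)) * (x (Suc i) - x i))
      - of_bool (holding s r y (T + 2)) * x (T + 1)"
  by (rule profit_eq_sum_holdings) (auto simp: buy_times_def sell_times_def)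

text \<open>Each period contributes its increment times a stock of 0 or 1, hence at most the
  positive part. Stock left over after time \<open>T + 1\<close> is feasible; since \<open>x\<close>
  is an arbitrary real sequence here, this costs the last summand.\<close>

lemma profit_feasible_le:
  assumes "feasible T B S"
  shows "profit x B S \<le> (\<Sum>i\<le>T. max 0 (x (Suc i) - x i)) + max 0 (- x (T + 1))"
proof -
  \<comment> \<open>Shifted by one: \<open>h i\<close> is the stock before trading at time
    \<open>i\<close>.\<close>
  define h :: "nat \<Rightarrow> real" where
    "h i = (case i of 0 \<Rightarrow> 0 | Suc t \<Rightarrow> of_int (stock_after B S t))" for i
  have sub: "B \<subseteq> {0..T+1}" "S \<subseteq> {1..T+1}"
    using assms by (auto simp: feasible_def)
  then have fin: "finite B" "finite S" and sub0: "S \<subseteq> {0..T+1}"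
    by (auto intro: finite_subset)
  have ins: "A \<inter> {..Suc t} = (if Suc t \<in> A then insert (Suc t) (A \<inter> {..t}) else A \<inter> {..t})"
    "A \<inter> {..0} = (if 0 \<in> A then {0} else {})" for A :: "nat set" and t
    by (auto simp: le_Suc_eq)
  have step: "h (Suc i) = h i + of_bool (i \<in> B) - of_bool (i \<in> S)" for i
    using fin by (cases i) (auto simp: h_def stock_after_def ins)
  have h01: "h (Suc i) \<in> {0, 1}" if "i \<le> T + 1" for i
    using assms that by (auto simp: h_def feasible_def)
  have bound: "h (Suc i) * c \<le> max 0 c" if "i \<le> T + 1" for i c
    using h01[OF that] by auto
  have "profit x B S = (\<Sum>i\<le>T. h (Suc i) * (x (Suc i) - x i)) + h (Suc (T + 1)) * (- x (T + 1))"
    using profit_eq_sum_holdings[where h = h and x = x, OF sub(1) sub0 _ step]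
    by (simp add: h_def)
  also have "\<dots> \<le> (\<Sum>i\<le>T. max 0 (x (Suc i) - x i)) + max 0 (- x (T + 1))"
    by (intro add_mono sum_mono bound) auto
  finally show ?thesis .
qed

lemma opt_eq:
  "opt T x = (\<Sum>i\<le>T. max 0 (x (Suc i) - x i)) + max 0 (- x (T + 1))"
proof -
  \<comment> \<open>A clairvoyant strategy attains the bound: \<open>x\<close> is fixed, so
    \<open>up\<close> may look one price ahead. Trading whenever \<open>h\<close> differs from
    \<open>up i\<close> makes the stock after time \<open>i\<close> equal to \<open>up i\<close>,
    and \<open>feasible_trades\<close> supplies feasibility. The case \<open>i > T\<close> serves
    the terminal summand.\<close>
  define up where "up i \<longleftrightarrow> (if i \<le> T then x i \<le> x (Suc i) else x i \<le> 0)" for i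
  define s :: "unit strategy" where
    "s = \<lparr>seed = return (count_space UNIV) (), trade = (\<lambda>i h _ _. h \<noteq> up i)\<rparr>"
  have hold: "holding s r y (Suc i) = up i" for r y i
    by (simp add: s_def)
  let ?P = "{profit x B S |B S. feasible T B S}"
  have "?P \<subseteq> (\<lambda>(B, S). profit x B S) ` (Pow {0..T+1} \<times> Pow {1..T+1})"
    by (auto simp: feasible_def)
  then have "finite ?P"
    by (rule finite_subset) auto
  moreover have "v \<le> (\<Sum>i\<le>T. max 0 (x (Suc i) - x i)) + max 0 (- x (T + 1))" if "v \<in> ?P" for v
    using that profit_feasible_le by blast
  moreover have "profit x (buy_times s T () x) (sell_times s T () x)
      = (\<Sum>i\<le>T. max 0 (x (Suc i) - x i)) + max 0 (- x (T + 1))" (is "?p = ?v")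
  proof -
    have "(\<Sum>i\<le>T. of_bool (up i) * (x (Suc i) - x i)) = (\<Sum>i\<le>T. max 0 (x (Suc i) - x i))"
      by (intro sum.cong) (auto simp: up_def)
    moreover have "of_bool (up (T + 1)) * x (T + 1) = - max 0 (- x (T + 1))"
      by (auto simp: up_def)
    moreover have "holding s () x (T + 2) = up (T + 1)"
      using hold[of "()" x "T + 1"] by (simp only: add_2_eq_Suc' Suc_eq_plus1[symmetric])
    ultimately show ?thesis
      by (simp only: profit_strategy hold)
  qed
  then have "?v \<in> ?P"
    using feasible_trades[of T s "()" x] by (intro CollectI exI conjI) (auto simp only:)
  ultimately show ?thesis
    unfolding opt_def by (intro Max_eqI)
qed

section \<open>Integration over the joint law of the prices\<close>

lemma price_dist_props:
  assumes "valid_market D"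
  shows prob_space_price_dist: "prob_space (price_dist D i)"
    and sets_price_dist: "sets (price_dist D i) = sets borel"
    and integrable_price_dist: "integrable (price_dist D i) (\<lambda>x. x)"
proof -
  have "D ! (i - 1) \<in> set D" if "i \<in> {1..length D}"
    using that by auto
  then show "prob_space (price_dist D i)" "sets (price_dist D i) = sets borel"
    "integrable (price_dist D i) (\<lambda>x. x)"
    using assms unfolding valid_market_def price_dist_def
    by (auto simp: prob_space_return integrable_iff_bounded nn_integral_return)
qed

lemma mean_price_boundary [simp]: "mean_price D 0 = 0" "mean_price D (Suc (length D)) = 0"
  by (simp_all add: mean_price_def price_dist_def integral_return)

locale market_law =
  fixes D :: market
  assumes valid: "valid_market D"

sublocale market_law \<subseteq> product_prob_space "price_dist D" "{0..length D + 1}"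
  by (simp add: product_prob_space_def product_prob_space_axioms_def product_sigma_finite_def
      prob_space_price_dist[OF valid] prob_space_imp_sigma_finite)

context market_law
begin

sublocale law: prob_space "joint_law D"
  unfolding joint_law_def by (rule prob_space_PiM) (rule prob_space_price_dist[OF valid])

lemmas sets_price [measurable_cong] = sets_price_dist[OF valid]

lemma sets_joint_law [measurable_cong]:
  "sets (joint_law D) = sets (PiM {0..length D + 1} (\<lambda>_. borel))"
  unfolding joint_law_def by (intro sets_PiM_cong refl sets_price)

lemma space_price [simp]: "space (price_dist D i) = UNIV"
  using sets_eq_imp_space_eq[OF sets_price[of i]] by simp

lemma component_measurable [measurable]:
  "i \<le> length D + 1 \<Longrightarrow> (\<lambda>x. x i) \<in> borel_measurable (joint_law D)"
  unfolding measurable_cong_sets[OF sets_joint_law refl]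
  by (rule measurable_component_singleton) auto

lemma distr_component:
  assumes "i \<le> length D + 1"
  shows "distr (joint_law D) (price_dist D i) (\<lambda>x. x i) = price_dist D i"
  using assms PiM_component[of i] by (simp add: joint_law_def)

lemma component_measurable_price:
  "i \<le> length D + 1 \<Longrightarrow> (\<lambda>x. x i) \<in> joint_law D \<rightarrow>\<^sub>M price_dist D i"
  by (subst measurable_cong_sets[OF refl sets_price]) (rule component_measurable)

lemma integral_component:
  fixes f :: "real \<Rightarrow> real"
  assumes "i \<le> length D + 1" and [measurable]: "f \<in> borel_measurable borel"
  shows "(\<integral>x. f (x i) \<partial>joint_law D) = (\<integral>y. f y \<partial>price_dist D i)"
proof -
  have "(\<integral>y. f y \<partial>price_dist D i) = (\<integral>y. f y \<partial>distr (joint_law D) (price_dist D i) (\<lambda>x. x i))"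
    by (simp only: distr_component[OF assms(1)])
  also have "\<dots> = (\<integral>x. f (x i) \<partial>joint_law D)"
    by (rule integral_distr[OF component_measurable_price[OF assms(1)]])
      (subst measurable_cong_sets[OF sets_price refl], rule assms(2))
  finally show ?thesis ..
qed

lemma integrable_component:
  assumes "i \<le> length D + 1"
  shows "integrable (joint_law D) (\<lambda>x. x i)"
proof -
  have "integrable (distr (joint_law D) (price_dist D i) (\<lambda>x. x i)) (\<lambda>y. y)"
    unfolding distr_component[OF assms] by (rule integrable_price_dist[OF valid])
  then show ?thesis
    by (subst (asm) integrable_distr_eq)
      (rule component_measurable_price[OF assms] measurable_ident_sets[OF sets_price] | assumption)+
qed

text \<open>The final price is 0 by its law, not at every sample point. This removes the terminal
  terms of the pathwise formulas in expectation.\<close>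

lemma AE_last_price: "AE x in joint_law D. x (Suc (length D)) = 0"
proof -
  have "AE y in price_dist D (Suc (length D)). y = 0"
    unfolding price_dist_def by (subst if_not_P, simp, subst AE_return) auto
  then show ?thesis
    unfolding joint_law_def
    by (intro AE_PiM_component prob_space_price_dist valid) auto
qed

text \<open>On the right, the value of \<open>x k\<close> is irrelevant. Keeping the outer integral over the full joint
  law avoids product measures with a missing coordinate.\<close>

lemma integral_resample:
  fixes f :: "(nat \<Rightarrow> real) \<Rightarrow> real"
  assumes k: "k \<le> length D + 1" and f: "integrable (joint_law D) f"
  shows "(\<integral>x. f x \<partial>joint_law D) = (\<integral>x. (\<integral>y. f (x(k := y)) \<partial>price_dist D k) \<partial>joint_law D)"
proof -
  let ?I = "{0..length D + 1} - {k}"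
  let ?N = "PiM ?I (price_dist D)"
  have ins: "insert k ?I = {0..length D + 1}" using k by auto
  have fI: "finite ?I" "k \<notin> ?I" by auto
  have f': "integrable (PiM (insert k ?I) (price_dist D)) f"
    using f by (simp only: joint_law_def ins)
  have "(\<lambda>(x, y). f (x(k := y))) \<in> borel_measurable (?N \<Otimes>\<^sub>M price_dist D k)"
    using measurable_compose[OF measurable_add_dim borel_measurable_integrable[OF f']]
    by (simp add: split_beta')
  then have meas: "(\<lambda>x. \<integral>y. f (x(k := y)) \<partial>price_dist D k) \<in> borel_measurable ?N"
    by (rule M.borel_measurable_lebesgue_integral)
  have sub: "?I \<subseteq> {0..length D + 1}" by auto
  \<comment> \<open>Fubini splits off coordinate \<open>k\<close>. The law of the other coordinates
    is the image of the joint law under restriction, so the outer integral can be pulled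
    back.\<close>
  have "(\<integral>x. f x \<partial>joint_law D) = (\<integral>x. (\<integral>y. f (x(k := y)) \<partial>price_dist D k) \<partial>?N)"
    using product_integral_insert[OF fI f'] by (simp only: joint_law_def ins)
  also have "\<dots> = (\<integral>x. (\<integral>y. f (x(k := y)) \<partial>price_dist D k)
      \<partial>distr (joint_law D) ?N (\<lambda>x. restrict x ?I))"
    using distr_PiM_restrict_finite[OF fI(1) sub] by (simp only: joint_law_def)
  also have "\<dots> = (\<integral>x. (\<integral>y. f ((restrict x ?I)(k := y)) \<partial>price_dist D k) \<partial>joint_law D)"
    by (rule integral_distr[OF _ meas]) (unfold joint_law_def, rule measurable_restrict_subset[OF sub])
  also have "\<dots> = (\<integral>x. (\<integral>y. f (x(k := y)) \<partial>price_dist D k) \<partial>joint_law D)"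
  \<comment> \<open>Sample points are undefined outside the index set, so deleting coordinate
    \<open>k\<close> before overwriting it changes nothing.\<close>
  proof (rule Bochner_Integration.integral_cong[OF refl])
    fix x assume "x \<in> space (joint_law D)"
    then have "x \<in> extensional {0..length D + 1}"
      by (auto simp: joint_law_def space_PiM PiE_def)
    then have "(restrict x ?I)(k := y) = x(k := y)" for y
      by (auto simp: fun_eq_iff restrict_def extensional_def)
    then show "(\<integral>y. f ((restrict x ?I)(k := y)) \<partial>price_dist D k)
        = (\<integral>y. f (x(k := y)) \<partial>price_dist D k)"
      by simp
  qed
  finally show ?thesis .
qed

end

section \<open>Expected profits\<close>

text \<open>The sum of the \<open>G\<^sub>i\<close> of the opening idea: the optimal online value,
  through which prophet and trader are compared.\<close>

definition greedy_value :: "market \<Rightarrow> real" where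
  "greedy_value D = (\<Sum>i\<le>length D. \<integral>x. max 0 (mean_price D (Suc i) - x) \<partial>price_dist D i)"

text \<open>The online constraint: \<open>trade\<close> is fed only the prices seen so far. Hence
  the stock carried from time \<open>i\<close> to \<open>Suc i\<close> ignores the price at
  \<open>Suc i\<close>.\<close>

lemma holding_cong:
  assumes "\<And>j. j < n \<Longrightarrow> x j = y j"
  shows "holding s r x n = holding s r y n"
  using assms
proof (induction n)
  case (Suc n)
  have "restrict x {0..n} = restrict y {0..n}"
    using Suc.prems by (auto simp: fun_eq_iff)
  moreover have "holding s r x n = holding s r y n"
    using Suc by simp
  ultimately show ?case by simp
qed simp

lemma integrable_of_bool_mult:
  fixes f :: "_ \<Rightarrow> real"
  assumes "Measurable.pred (M) P" "integrable (M) f"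
  shows "integrable (M) (\<lambda>x. of_bool (P x) * f x)"
  by (rule Bochner_Integration.integrable_bound[OF assms(2)])
    (use assms in \<open>auto intro!: borel_measurable_times measurable_of_bool\<close>)

lemma integrable_max_0:
  fixes f :: "_ \<Rightarrow> real"
  assumes "integrable M f"
  shows "integrable M (\<lambda>x. max 0 (f x))"
  using assms by auto

section \<open>Expected profit of online strategies\<close>

context market_law
begin

lemma measurable_holding:
  assumes trade: "\<And>i h. i \<le> length D + 1 \<Longrightarrow>
      Measurable.pred (PiM {0..i} (\<lambda>_. borel)) (trade s i h r)"
    and "n \<le> length D + 2"
  shows "Measurable.pred (joint_law D) (\<lambda>x. holding s r x n)"
  using assms(2)
proof (induction n)
  case (Suc n)
  have *: "(\<lambda>x. restrict x {0..n}) \<in> joint_law D \<rightarrow>\<^sub>M PiM {0..n} (\<lambda>_. borel)"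
    unfolding measurable_cong_sets[OF sets_joint_law refl]
    by (rule measurable_restrict_subset) (use Suc.prems in auto)
  have [measurable]: "Measurable.pred (joint_law D) (\<lambda>x. trade s n h r (restrict x {0..n}))" for h
    by (rule measurable_compose[OF * trade]) (use Suc.prems in simp)
  have [measurable]: "Measurable.pred (joint_law D) (\<lambda>x. holding s r x n)"
    by (rule Suc.IH) (use Suc.prems in simp)
  \<comment> \<open>The state is itself an argument of \<open>trade\<close>; splitting on it leaves
    a Boolean combination of measurable predicates.\<close>
  have eq: "holding s r x (Suc n) \<longleftrightarrow>
      (holding s r x n \<and> \<not> trade s n True r (restrict x {0..n}))
      \<or> (\<not> holding s r x n \<and> trade s n False r (restrict x {0..n}))" for x
    by auto
  show ?case
    unfolding eq by measurable
qed simp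

text \<open>For a fixed seed \<open>r\<close>, the stock held between times \<open>i\<close> and
  \<open>Suc i\<close> is independent of the later price, which may therefore be replaced by its
  mean.\<close>

lemma
  assumes trade: "\<And>i h. i \<le> length D + 1 \<Longrightarrow>
      Measurable.pred (PiM {0..i} (\<lambda>_. borel)) (trade s i h r)"
  shows integrable_profit: "integrable (joint_law D)
      (\<lambda>x. profit x (buy_times s (length D) r x) (sell_times s (length D) r x))" (is "integrable _ ?pr")
    and integral_profit: "(\<integral>x. profit x (buy_times s (length D) r x) (sell_times s (length D) r x)
      \<partial>joint_law D) = (\<Sum>i\<le>length D.
      \<integral>x. of_bool (holding s r x (Suc i)) * (mean_price D (Suc i) - x i) \<partial>joint_law D)"
proof -
  note hold = measurable_holding[where s = s and r = r, OF trade]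
  have int1: "integrable (joint_law D) (\<lambda>x. of_bool (holding s r x (Suc i)) * (x (Suc i) - x i))"
    if "i \<le> length D" for i
    using that by (intro integrable_of_bool_mult hold Bochner_Integration.integrable_diff
      integrable_component) auto
  have int2: "integrable (joint_law D)
      (\<lambda>x. of_bool (holding s r x (length D + 2)) * x (length D + 1))"
    by (intro integrable_of_bool_mult hold integrable_component) auto
  show "integrable (joint_law D) ?pr"
    unfolding profit_strategy
    by (intro Bochner_Integration.integrable_diff Bochner_Integration.integrable_sum int1 int2) auto
  have last: "(\<integral>x. of_bool (holding s r x (length D + 2)) * x (length D + 1) \<partial>joint_law D) = 0"
    by (rule integral_eq_zero_AE) (use AE_last_price in \<open>auto simp del: holding.simps\<close>)
  have step: "(\<integral>x. of_bool (holding s r x (Suc i)) * (x (Suc i) - x i) \<partial>joint_law D)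
      = (\<integral>x. of_bool (holding s r x (Suc i)) * (mean_price D (Suc i) - x i) \<partial>joint_law D)"
    if i: "i \<le> length D" for i
  proof -
    \<comment> \<open>Resampling the price at \<open>Suc i\<close> leaves the stock unchanged, so
      the inner integral acts on that price alone.\<close>
    have hold_upd: "holding s r (x(Suc i := y)) (Suc i) = holding s r x (Suc i)" for x y
      by (rule holding_cong) auto
    have "(\<integral>y. y - c \<partial>price_dist D (Suc i)) = mean_price D (Suc i) - c" for c
      using M.prob_space[of "Suc i"]
      by (simp add: integrable_price_dist[OF valid] mean_price_def)
    then show ?thesis
      using i by (subst integral_resample[where k = "Suc i", OF _ int1])
        (simp_all add: hold_upd del: holding.simps)
  qed
  show "(\<integral>x. ?pr x \<partial>joint_law D) = (\<Sum>i\<le>length D.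
      \<integral>x. of_bool (holding s r x (Suc i)) * (mean_price D (Suc i) - x i) \<partial>joint_law D)"
    unfolding profit_strategy
    using int1
    by (subst Bochner_Integration.integral_diff[OF _ int2])
      (auto intro!: Bochner_Integration.integrable_sum
        simp: last[unfolded Suc_eq_plus1[symmetric]] Bochner_Integration.integral_sum step
        simp del: holding.simps sum_of_bool_mult_eq add_2_eq_Suc')
qed

lemma greedy_value_joint_law:
  "greedy_value D = (\<Sum>i\<le>length D. \<integral>x. max 0 (mean_price D (Suc i) - x i) \<partial>joint_law D)"
  unfolding greedy_value_def by (intro sum.cong refl integral_component[symmetric]) auto

text \<open>Period by period, a 0-1 factor times a quantity is at most the positive part of that
  quantity.\<close>

lemma integral_profit_le_greedy_value:
  assumes trade: "\<And>i h. i \<le> length D + 1 \<Longrightarrow>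
      Measurable.pred (PiM {0..i} (\<lambda>_. borel)) (trade s i h r)"
  shows "(\<integral>x. profit x (buy_times s (length D) r x) (sell_times s (length D) r x) \<partial>joint_law D)
    \<le> greedy_value D"
proof (subst integral_profit[OF trade], assumption,
    unfold greedy_value_joint_law, rule sum_mono, rule integral_mono)
  fix i assume "i \<in> {..length D}"
  then have i: "i \<le> length D" by simp
  then have int: "integrable (joint_law D) (\<lambda>x. mean_price D (Suc i) - x i)"
    by (intro Bochner_Integration.integrable_diff integrable_component) auto
  show "integrable (joint_law D) (\<lambda>x. of_bool (holding s r x (Suc i)) * (mean_price D (Suc i) - x i))"
    using i by (intro integrable_of_bool_mult int measurable_holding trade) auto
  show "integrable (joint_law D) (\<lambda>x. max 0 (mean_price D (Suc i) - x i))"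
    by (intro integrable_max_0 int)
qed auto

text \<open>Randomization does not help: the bound holds for every fixed seed, and Fubini averages
  it over the seeds.\<close>

lemma expected_alg_le_greedy_value:
  assumes "online_algorithm C A" "D \<in> C"
  shows "expected_alg A D \<le> greedy_value D"
proof -
  let ?S = "seed (A D)"
  let ?pr = "\<lambda>r x. profit x (buy_times (A D) (length D) r x) (sell_times (A D) (length D) r x)"
  interpret seed: prob_space ?S
    using assms by (auto simp: online_algorithm_def)
  interpret pair: pair_prob_space ?S "joint_law D" ..
  have pr: "(\<integral>x. ?pr r x \<partial>joint_law D) \<le> greedy_value D" if r: "r \<in> space ?S" for r
  proof (rule integral_profit_le_greedy_value)
    fix i h assume "i \<le> length D + 1"
    then have "Measurable.pred (?S \<Otimes>\<^sub>M PiM {0..i} (\<lambda>_. borel)) (\<lambda>(r, x). trade (A D) i h r x)"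
      using assms by (auto simp: online_algorithm_def)
    then show "Measurable.pred (PiM {0..i} (\<lambda>_. borel)) (trade (A D) i h r)"
      by (rule measurable_compose[OF measurable_Pair1'[OF r], THEN measurable_cong[THEN iffD1, rotated]]) simp
  qed
  have nonneg: "0 \<le> greedy_value D"
    unfolding greedy_value_def by (intro sum_nonneg Bochner_Integration.integral_nonneg) auto
  show ?thesis
  proof (cases "integrable (?S \<Otimes>\<^sub>M joint_law D) (\<lambda>(r, x). ?pr r x)")
    case True
    have "expected_alg A D = (\<integral>r. (\<integral>x. ?pr r x \<partial>joint_law D) \<partial>?S)"
      unfolding expected_alg_def using pair.integral_fst'[OF True] by simp
    also have "\<dots> \<le> (\<integral>r. greedy_value D \<partial>?S)"
      using pair.integrable_fst'[OF True] by (intro integral_mono pr) auto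
    finally show ?thesis by (simp add: seed.prob_space)
  next
    \<comment> \<open>A non-integrable profit has Bochner integral 0 by convention, which the
      nonnegative greedy value still bounds.\<close>
    case False
    then show ?thesis
      using nonneg by (simp add: expected_alg_def not_integrable_integral_eq)
  qed
qed

lemma expected_alg_buy_low_sell_high:
  "expected_alg buy_low_sell_high D = greedy_value D"
proof -
  let ?s = "buy_low_sell_high D"
  let ?pr = "\<lambda>x. profit x (buy_times ?s (length D) () x) (sell_times ?s (length D) () x)"
  have seed: "seed ?s = return (count_space UNIV) ()"
    by (simp add: buy_low_sell_high_def)
  interpret seed: prob_space "seed ?s"
    unfolding seed by (rule prob_space_return) simp
  interpret pair: pair_prob_space "seed ?s" "joint_law D" ..
  have trade: "Measurable.pred (PiM {0..i} (\<lambda>_. borel)) (trade ?s i h ())" for i h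
    by (cases h) (simp_all add: buy_low_sell_high_def)
  \<comment> \<open>Whatever the previous state, the algorithm holds exactly when the expected
    increment is nonnegative, so each period yields the full positive part.\<close>
  have hold: "holding ?s () x (Suc i) \<longleftrightarrow> x i \<le> mean_price D (Suc i)" if "i \<le> length D" for x i
    using that by (auto simp: buy_low_sell_high_def not_le)
  have "integrable (joint_law D) ?pr"
    by (rule integrable_profit) (rule trade)
  then have meas: "?pr \<in> borel_measurable (joint_law D)"
    by (rule borel_measurable_integrable)
  have "expected_alg buy_low_sell_high D = (\<integral>z. ?pr (snd z) \<partial>(seed ?s \<Otimes>\<^sub>M joint_law D))"
    unfolding expected_alg_def by (simp add: split_beta')
  also have "\<dots> = (\<integral>x. ?pr x \<partial>distr (seed ?s \<Otimes>\<^sub>M joint_law D) (joint_law D) snd)"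
    by (rule integral_distr[OF measurable_snd meas, symmetric])
  \<comment> \<open>The seed is a single point of mass 1, so projecting it away recovers the law of
    the prices.\<close>
  also have "distr (seed ?s \<Otimes>\<^sub>M joint_law D) (joint_law D) snd = joint_law D"
  proof (rule measure_eqI)
    fix X assume "X \<in> sets (distr (seed ?s \<Otimes>\<^sub>M joint_law D) (joint_law D) snd)"
    then have X: "X \<in> sets (joint_law D)" by simp
    then have "snd -` X \<inter> space (seed ?s \<Otimes>\<^sub>M joint_law D) = space (seed ?s) \<times> X"
      using sets.sets_into_space by (auto simp: space_pair_measure)
    then show "emeasure (distr (seed ?s \<Otimes>\<^sub>M joint_law D) (joint_law D) snd) X
        = emeasure (joint_law D) X"
      using X by (simp add: emeasure_distr law.emeasure_pair_measure_Times seed.emeasure_space_1)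
  qed simp
  also have "(\<integral>x. ?pr x \<partial>joint_law D) = greedy_value D"
    unfolding integral_profit[where s = ?s and r = "()", OF trade] greedy_value_joint_law
    by (intro sum.cong Bochner_Integration.integral_cong)
      (auto simp: hold simp del: holding.simps)
  finally show ?thesis .
qed

section \<open>The prophet's expected profit compared with the greedy value\<close>

lemma integrable_difference:
  assumes "i \<le> length D + 1" "j \<le> length D + 1"
  shows "integrable (joint_law D) (\<lambda>x. max 0 (x i - x j))"
  by (intro integrable_max_0 Bochner_Integration.integrable_diff integrable_component assms)

lemma expected_opt_eq:
  "expected_opt D = (\<Sum>i\<le>length D. \<integral>x. max 0 (x (Suc i) - x i) \<partial>joint_law D)"
proof -
  have int: "integrable (joint_law D) (\<lambda>x. \<Sum>i\<le>length D. max 0 (x (Suc i) - x i))"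
    by (intro Bochner_Integration.integrable_sum integrable_difference) auto
  have int_last: "integrable (joint_law D) (\<lambda>x. max 0 (- x (length D + 1)))"
    by (intro integrable_max_0 Bochner_Integration.integrable_minus integrable_component) auto
  have "(\<integral>x. max 0 (- x (length D + 1)) \<partial>joint_law D) = 0"
    by (rule integral_eq_zero_AE) (use AE_last_price in auto)
  then show ?thesis
    unfolding expected_opt_def opt_eq
    by (subst Bochner_Integration.integral_add[OF int int_last])
      (simp add: Bochner_Integration.integral_sum integrable_difference del: sum.atMost_Suc)
qed

text \<open>The two sides are the means of the positive and negative parts of the centred price,
  whose mean is 0.\<close>

lemma expected_excess_eq_shortfall:
  "(\<integral>x. max 0 (x - mean_price D i) \<partial>price_dist D i)
    = (\<integral>x. max 0 (mean_price D i - x) \<partial>price_dist D i)"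
proof -
  note int = integrable_price_dist[OF valid, of i]
  have "(\<integral>x. max 0 (x - mean_price D i) \<partial>price_dist D i)
      - (\<integral>x. max 0 (mean_price D i - x) \<partial>price_dist D i)
      = (\<integral>x. max 0 (x - mean_price D i) - max 0 (mean_price D i - x) \<partial>price_dist D i)"
    by (intro Bochner_Integration.integral_diff[symmetric] integrable_max_0) (simp_all add: int)
  also have "\<dots> = (\<integral>x. x - mean_price D i \<partial>price_dist D i)"
    by (intro Bochner_Integration.integral_cong) auto
  also have "\<dots> = 0"
    using int M.prob_space[of i] by (simp add: mean_price_def)
  finally show ?thesis by simp
qed

text \<open>Bounding the upper part of each rise moves the index up by one, so the second copy of
  the greedy value lacks its term at 0; this is the subtracted
  \<open>max 0 (mean_price D 1)\<close>. The remaining sum collects the falls of the means,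
  including the last one to 0.\<close>

lemma expected_opt_le:
  "expected_opt D \<le> 2 * greedy_value D - max 0 (mean_price D 1)
    + (\<Sum>i<length D. max 0 (mean_price D (Suc i) - mean_price D (Suc (Suc i))))"
proof -
  define G where "G i = (\<integral>x. max 0 (mean_price D (Suc i) - x) \<partial>price_dist D i)" for i
  define L where "L i = (\<integral>x. max 0 (mean_price D i - x) \<partial>price_dist D i)" for i
  let ?d = "\<lambda>i. max 0 (mean_price D i - mean_price D (Suc i))"
  note int = integrable_price_dist[OF valid]
  have opt: "(\<integral>x. max 0 (x (Suc i) - x i) \<partial>joint_law D) \<le> L (Suc i) + G i"
    if i: "i \<le> length D" for i
  proof -
    have int1: "integrable (joint_law D) (\<lambda>x. max 0 (x (Suc i) - mean_price D (Suc i)))"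
      and int2: "integrable (joint_law D) (\<lambda>x. max 0 (mean_price D (Suc i) - x i))"
      using i by (auto intro!: integrable_max_0 integrable_component Bochner_Integration.integrable_diff)
    have "(\<integral>x. max 0 (x (Suc i) - x i) \<partial>joint_law D)
        \<le> (\<integral>x. max 0 (x (Suc i) - mean_price D (Suc i)) + max 0 (mean_price D (Suc i) - x i)
            \<partial>joint_law D)"
      using i by (intro integral_mono integrable_difference
          Bochner_Integration.integrable_add int1 int2) auto
    also have "\<dots> = (\<integral>x. max 0 (x (Suc i) - mean_price D (Suc i)) \<partial>joint_law D)
        + (\<integral>x. max 0 (mean_price D (Suc i) - x i) \<partial>joint_law D)"
      by (rule Bochner_Integration.integral_add[OF int1 int2])
    also have "\<dots> = L (Suc i) + G i"
      using i integral_component[of "Suc i" "\<lambda>y. max 0 (y - mean_price D (Suc i))"]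
        integral_component[of i "\<lambda>y. max 0 (mean_price D (Suc i) - y)"]
      by (simp add: L_def G_def expected_excess_eq_shortfall)
    finally show ?thesis .
  qed
  have L_le: "L i \<le> G i + ?d i" for i
  proof -
    have "L i \<le> (\<integral>x. max 0 (mean_price D (Suc i) - x) + ?d i \<partial>price_dist D i)"
      unfolding L_def by (intro integral_mono integrable_max_0 Bochner_Integration.integrable_add)
        (auto simp: int)
    also have "\<dots> = G i + ?d i"
      using M.prob_space[of i] int[of i] unfolding G_def
      by (subst Bochner_Integration.integral_add) (auto intro!: integrable_max_0)
    finally show ?thesis .
  qed
  \<comment> \<open>The price at time \<open>T + 1\<close> is the constant 0, so the shifted sum of
    shortfalls stops at \<open>T\<close>.\<close>
  have L_last: "L (Suc (length D)) = 0"
    unfolding L_def by (simp add: price_dist_def integral_return)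
  have G_0: "G 0 = max 0 (mean_price D 1)"
    unfolding G_def by (simp add: price_dist_def integral_return)
  have greedy: "greedy_value D = G 0 + (\<Sum>i<length D. G (Suc i))"
    unfolding greedy_value_def G_def[symmetric] by (rule sum.atMost_shift)
  have "expected_opt D \<le> (\<Sum>i\<le>length D. L (Suc i) + G i)"
    unfolding expected_opt_eq by (intro sum_mono opt) auto
  also have "\<dots> = (\<Sum>i<length D. L (Suc i)) + greedy_value D"
    unfolding greedy_value_def G_def[symmetric]
    by (simp add: sum.distrib lessThan_Suc_atMost[symmetric] L_last)
  also have "\<dots> \<le> (\<Sum>i<length D. G (Suc i) + ?d (Suc i)) + greedy_value D"
    by (intro add_right_mono sum_mono L_le)
  also have "\<dots> = 2 * greedy_value D - max 0 (mean_price D 1) + (\<Sum>i<length D. ?d (Suc i))"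
    using greedy G_0 by (simp add: sum.distrib)
  finally show ?thesis .
qed

text \<open>Means start and end at 0, so their total fall equals their total rise, which Jensen's
  inequality bounds by the greedy value.\<close>

lemma sum_mean_price_falls_le:
  "(\<Sum>i<length D. max 0 (mean_price D (Suc i) - mean_price D (Suc (Suc i)))) \<le> greedy_value D"
proof -
  let ?m = "mean_price D"
  have "(\<Sum>i<length D. max 0 (?m (Suc i) - ?m (Suc (Suc i))))
      \<le> (\<Sum>i\<le>length D. max 0 (?m i - ?m (Suc i)))"
    by (subst sum.atMost_shift) simp
  also have "\<dots> = (\<Sum>i\<le>length D. max 0 (?m (Suc i) - ?m i)) - (\<Sum>i\<le>length D. ?m (Suc i) - ?m i)"
    by (subst sum_subtractf[symmetric]) (intro sum.cong, auto)
  also have "(\<Sum>i\<le>length D. ?m (Suc i) - ?m i) = 0"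
    using sum_lessThan_telescope[of ?m "Suc (length D)"] by (simp only: lessThan_Suc_atMost) simp
  also have "(\<Sum>i\<le>length D. max 0 (?m (Suc i) - ?m i)) - 0 \<le> greedy_value D"
    unfolding greedy_value_def diff_0_right
  proof (rule sum_mono)
    fix i
    note int = integrable_price_dist[OF valid, of i]
    have "?m (Suc i) - ?m i = (\<integral>x. ?m (Suc i) - x \<partial>price_dist D i)"
      using int M.prob_space[of i] by (simp add: mean_price_def[of D i])
    also have "\<dots> \<le> (\<integral>x. max 0 (?m (Suc i) - x) \<partial>price_dist D i)"
      by (intro integral_mono integrable_max_0) (auto simp: int)
    finally show "max 0 (?m (Suc i) - ?m i) \<le> (\<integral>x. max 0 (?m (Suc i) - x) \<partial>price_dist D i)"
      by (simp add: Bochner_Integration.integral_nonneg)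
  qed
  finally show ?thesis .
qed

text \<open>An exact value for the prophet's gain in one period, for use in the lower bounds:
  resample the later price, then project onto the earlier one.\<close>

lemma integral_difference:
  assumes i: "i \<le> length D"
  shows "(\<integral>x. max 0 (x (Suc i) - x i) \<partial>joint_law D)
    = (\<integral>x. (\<integral>y. max 0 (y - x) \<partial>price_dist D (Suc i)) \<partial>price_dist D i)"
proof -
  have [measurable]: "(\<lambda>x. \<integral>y. max 0 (y - x) \<partial>price_dist D (Suc i)) \<in> borel_measurable borel"
    by (rule M.borel_measurable_lebesgue_integral) measurable
  have "(\<integral>x. max 0 (x (Suc i) - x i) \<partial>joint_law D)
      = (\<integral>x. (\<integral>y. max 0 (y - x i) \<partial>price_dist D (Suc i)) \<partial>joint_law D)"
    using i by (subst integral_resample[where k = "Suc i"]) (auto intro: integrable_difference)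
  also have "\<dots> = (\<integral>x. (\<integral>y. max 0 (y - x) \<partial>price_dist D (Suc i)) \<partial>price_dist D i)"
    using i by (intro integral_component) auto
  finally show ?thesis .
qed

end

section \<open>Competitive ratios of Buy Low Sell High\<close>

lemma competitive_buy_low_sell_high_3: "competitive all_markets buy_low_sell_high 3"
  unfolding competitive_def
proof (intro exI ballI)
  fix D assume "D \<in> all_markets"
  then interpret market_law D
    by unfold_locales (simp add: all_markets_def)
  show "expected_opt D \<le> 3 * expected_alg buy_low_sell_high D + 0"
    unfolding expected_alg_buy_low_sell_high
    using expected_opt_le sum_mean_price_falls_le by linarith
qed

text \<open>The union over \<mu> demands one additive constant for all means. The constant 0 works
  because the only fall of the means cancels the subtracted term of \<open>expected_opt_le\<close>
  exactly.\<close>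

lemma competitive_buy_low_sell_high_2:
  "competitive (\<Union>\<mu>. equal_mean_markets \<mu>) buy_low_sell_high 2"
  unfolding competitive_def
proof (intro exI ballI)
  fix D assume "D \<in> (\<Union>\<mu>. equal_mean_markets \<mu>)"
  then obtain \<mu> where valid: "valid_market D"
    and mean: "\<And>i. i \<in> {1..length D} \<Longrightarrow> mean_price D i = \<mu>"
    by (auto simp: equal_mean_markets_def)
  interpret market_law D
    by unfold_locales (rule valid)
  obtain n where n: "length D = Suc n"
    using valid by (cases D) (auto simp: valid_market_def)
  \<comment> \<open>All falls vanish except the last, from \<mu> to the final price 0.\<close>
  have "mean_price D (Suc (length D)) = 0" by simp
  then have "(\<Sum>i<length D. max 0 (mean_price D (Suc i) - mean_price D (Suc (Suc i)))) = max 0 \<mu>"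
    unfolding n by (simp add: mean n)
  then show "expected_opt D \<le> 2 * expected_alg buy_low_sell_high D + 0"
    unfolding expected_alg_buy_low_sell_high
    using expected_opt_le mean[of 1] n by simp
qed

section \<open>Alternating markets\<close>

text \<open>List positions start at 0, so \<open>P\<close> sits at the odd times and
  \<open>Q\<close> at the even ones, and the last price comes from \<open>Q\<close>.\<close>

definition alternating_market :: "real measure \<Rightarrow> real measure \<Rightarrow> nat \<Rightarrow> market" where
  "alternating_market P Q n = map (\<lambda>i. if even i then P else Q) [0..<2 * n]"

text \<open>What the prophet gains on average between a \<open>P\<close>-price and the next,
  independent \<open>Q\<close>-price.\<close>

definition expected_rise :: "real measure \<Rightarrow> real measure \<Rightarrow> real" where
  "expected_rise P Q = (\<integral>x. (\<integral>y. max 0 (y - x) \<partial>Q) \<partial>P)"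

text \<open>The term \<open>G\<^sub>i\<close> of a period leading from \<open>P\<close> to
  \<open>Q\<close>: the most an online trader can expect from it.\<close>

definition expected_discount :: "real measure \<Rightarrow> real measure \<Rightarrow> real" where
  "expected_discount P Q = (\<integral>x. max 0 ((\<integral>y. y \<partial>Q) - x) \<partial>P)"

lemma length_alternating_market [simp]: "length (alternating_market P Q n) = 2 * n"
  by (simp add: alternating_market_def)

lemma price_dist_alternating_market:
  "i < 2 * n \<Longrightarrow> price_dist (alternating_market P Q n) (Suc i) = (if even i then P else Q)"
  by (simp add: price_dist_def alternating_market_def)

lemma expected_rise_nonneg: "0 \<le> expected_rise P Q"
  unfolding expected_rise_def by (intro Bochner_Integration.integral_nonneg) auto

lemma sum_alternating:
  "(\<Sum>i<2 * n. if even i then a else b) = real n * (a + b)"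
  using sum_split_even_odd[of "\<lambda>_. a" "\<lambda>_. b" n] by (simp add: distrib_left)

context
  fixes P Q :: "real measure" and n :: nat
  assumes valid: "valid_market (alternating_market P Q n)"
begin

interpretation market_law "alternating_market P Q n"
  by unfold_locales (rule valid)

text \<open>The initial period, from price 0 to \<open>P\<close>, is worth the mean of
  \<open>P\<close>. The final one, from \<open>Q\<close> to 0, is counted as if another
  \<open>P\<close>-price followed, which completes the \<open>n\<close>-th pair.\<close>

lemma greedy_value_alternating_market_le:
  assumes "0 \<le> (\<integral>x. x \<partial>P)"
  shows "greedy_value (alternating_market P Q n)
    \<le> (\<integral>x. x \<partial>P) + real n * (expected_discount P Q + expected_discount Q P)"
proof -
  let ?D = "alternating_market P Q n"
  define t where "t i = (\<integral>x. max 0 (mean_price ?D (Suc i) - x) \<partial>price_dist ?D i)" for i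
  note price = price_dist_alternating_market[of _ n P Q]
  have n: "0 < n"
    using valid by (auto simp: valid_market_def alternating_market_def)
  have t_0: "t 0 = (\<integral>x. x \<partial>P)"
    using n price[of 0] assms
    by (simp add: t_def mean_price_def price_dist_def[of _ 0] integral_return)
  have t_Suc: "t (Suc i) \<le> (if even i then expected_discount P Q else expected_discount Q P)"
    if i: "i < 2 * n" for i
  proof (cases "Suc i < 2 * n")
    case True
    then show ?thesis
      using price[of i] price[of "Suc i"] by (simp add: t_def expected_discount_def mean_price_def)
  next
    case False
    then have last: "Suc i = 2 * n" using i by simp
    then have "odd i" by presburger
    then have Q: "price_dist ?D (Suc i) = Q" using price[OF i] by simp
    have "mean_price ?D (Suc (Suc i)) = 0"
      using mean_price_boundary(2)[of ?D] by (simp add: last)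
    then have "t (Suc i) = (\<integral>x. max 0 (0 - x) \<partial>price_dist ?D (Suc i))"
      by (simp add: t_def)
    also have "\<dots> \<le> (\<integral>x. max 0 ((\<integral>y. y \<partial>P) - x) \<partial>price_dist ?D (Suc i))"
      using assms by (intro integral_mono integrable_max_0 Bochner_Integration.integrable_diff
          integrable_price_dist[OF valid]) auto
    finally show ?thesis
      using \<open>odd i\<close> by (simp add: Q expected_discount_def)
  qed
  have "greedy_value ?D = t 0 + (\<Sum>i<2 * n. t (Suc i))"
    unfolding greedy_value_def t_def[symmetric] length_alternating_market by (rule sum.atMost_shift)
  also have "\<dots> \<le> t 0 + (\<Sum>i<2 * n. if even i then expected_discount P Q else expected_discount Q P)"
    by (intro add_left_mono sum_mono t_Suc) auto
  finally show ?thesis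
    by (simp add: t_0 sum_alternating)
qed

text \<open>Between \<open>2 * n\<close> prices lie \<open>n\<close> periods from \<open>P\<close>
  to \<open>Q\<close> but only \<open>n - 1\<close> back, hence the subtracted term. The two
  boundary periods are nonnegative and dropped.\<close>

lemma expected_opt_alternating_market_ge:
  "real n * (expected_rise P Q + expected_rise Q P) - expected_rise Q P
    \<le> expected_opt (alternating_market P Q n)"
proof -
  let ?D = "alternating_market P Q n"
  let ?e = "\<lambda>i. if even i then expected_rise P Q else expected_rise Q P"
  define t where "t i = (\<integral>x. max 0 (x (Suc i) - x i) \<partial>joint_law ?D)" for i
  note price = price_dist_alternating_market[of _ n P Q]
  have n: "0 < n"
    using valid by (auto simp: valid_market_def alternating_market_def)
  then obtain k where "n = Suc k"
    using gr0_implies_Suc by blast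
  then obtain m where m: "2 * n = Suc m" "odd m"
    using that[of "2 * k + 1"] by simp
  have t_nonneg: "0 \<le> t i" for i
    unfolding t_def by (intro Bochner_Integration.integral_nonneg) auto
  have "real n * (expected_rise P Q + expected_rise Q P) - expected_rise Q P
      = (\<Sum>i<2 * n. ?e i) - expected_rise Q P"
    by (simp add: sum_alternating)
  also have "\<dots> = (\<Sum>i<m. ?e i)"
    using m by simp
  also have "\<dots> = (\<Sum>i<m. t (Suc i))"
  proof (intro sum.cong refl)
    fix i assume "i \<in> {..<m}"
    then show "?e i = t (Suc i)"
      using price[of i] price[of "Suc i"] m integral_difference[of "Suc i"]
      by (simp add: t_def expected_rise_def)
  qed
  also have "\<dots> \<le> t 0 + (\<Sum>i<2 * n. t (Suc i))"
    unfolding m using t_nonneg by simp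
  also have "\<dots> = expected_opt ?D"
    unfolding expected_opt_eq t_def[symmetric] length_alternating_market
    by (rule sum.atMost_shift[symmetric])
  finally show ?thesis .
qed

end

text \<open>The strict inequality makes the prophet's advantage grow linearly in \<open>n\<close>,
  while the boundary terms and the additive constant stay fixed.\<close>

lemma not_competitive_alternating_market:
  assumes A: "online_algorithm C A" and \<alpha>: "0 \<le> \<alpha>"
    and C: "\<And>n. 0 < n \<Longrightarrow> alternating_market P Q n \<in> C"
    and markets: "\<And>n. 0 < n \<Longrightarrow> valid_market (alternating_market P Q n)"
    and mean: "0 \<le> (\<integral>x. x \<partial>P)"
    and less: "\<alpha> * (expected_discount P Q + expected_discount Q P)
      < expected_rise P Q + expected_rise Q P"
  shows "\<not> competitive C A \<alpha>"
proof
  let ?p = "\<integral>x. x \<partial>P"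
  let ?g = "expected_discount P Q + expected_discount Q P"
  let ?r = "expected_rise P Q + expected_rise Q P"
  assume "competitive C A \<alpha>"
  then obtain c where c: "\<And>D. D \<in> C \<Longrightarrow> expected_opt D \<le> \<alpha> * expected_alg A D + c"
    by (auto simp: competitive_def)
  have bound: "real n * (?r - \<alpha> * ?g) \<le> \<alpha> * ?p + c + expected_rise Q P" if n: "0 < n" for n
  proof -
    let ?D = "alternating_market P Q n"
    interpret market_law ?D
      by unfold_locales (rule markets[OF n])
    have "expected_alg A ?D \<le> ?p + real n * ?g"
      using expected_alg_le_greedy_value[OF A C[OF n]]
        greedy_value_alternating_market_le[OF markets[OF n] mean] by linarith
    then have "\<alpha> * expected_alg A ?D \<le> \<alpha> * (?p + real n * ?g)"
      using \<alpha> by (rule mult_left_mono)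
    then have "real n * ?r - expected_rise Q P \<le> \<alpha> * (?p + real n * ?g) + c"
      using c[OF C[OF n]] expected_opt_alternating_market_ge[OF markets[OF n]] by linarith
    then show ?thesis by (simp add: algebra_simps)
  qed
  \<comment> \<open>The Archimedean property gives a \<open>k\<close> that may be 0;
    \<open>Suc k\<close> is the positive length that contradicts \<open>bound\<close>.\<close>
  obtain k where "\<alpha> * ?p + c + expected_rise Q P < real k * (?r - \<alpha> * ?g)"
    using reals_Archimedean3[of "?r - \<alpha> * ?g"] less by auto
  moreover have "real k * (?r - \<alpha> * ?g) \<le> real (Suc k) * (?r - \<alpha> * ?g)"
    using less by (intro mult_right_mono) auto
  ultimately show False using bound[of "Suc k"] by linarith
qed

section \<open>Two-point distributions and the extremal markets\<close>

definition two_point :: "real \<Rightarrow> real \<Rightarrow> real \<Rightarrow> real measure" where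
  "two_point p a b = distr (measure_pmf (bernoulli_pmf p)) borel (\<lambda>t. if t then a else b)"

lemma integral_two_point:
  fixes f :: "real \<Rightarrow> real"
  assumes "0 \<le> p" "p \<le> 1" and f: "f \<in> borel_measurable borel"
  shows "(\<integral>x. f x \<partial>two_point p a b) = p * f a + (1 - p) * f b"
  unfolding two_point_def using assms by (subst integral_distr) auto

lemma valid_market_alternating_two_point:
  assumes "0 < n" "0 \<le> a" "0 \<le> b" "0 \<le> a'" "0 \<le> b'"
  shows "valid_market (alternating_market (two_point p a b) (two_point p' a' b') n)"
proof -
  have "prob_space (two_point p a b) \<and> sets (two_point p a b) = sets borel
      \<and> (AE x in two_point p a b. 0 \<le> x) \<and> integrable (two_point p a b) (\<lambda>x. x)"
    if "0 \<le> a" "0 \<le> b" for p a b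
  proof (intro conjI)
    show "prob_space (two_point p a b)"
      unfolding two_point_def by (intro prob_space.prob_space_distr prob_space_measure_pmf) auto
    show "AE x in two_point p a b. 0 \<le> x"
      unfolding two_point_def using that by (subst AE_distr_iff) auto
    show "integrable (two_point p a b) (\<lambda>x. x)"
      unfolding two_point_def
      by (subst integrable_distr_eq) (auto intro!: integrable_measure_pmf_finite)
  qed (simp add: two_point_def)
  then show ?thesis
    using assms by (auto simp: valid_market_def alternating_market_def)
qed

lemma expected_rise_two_point:
  assumes "0 \<le> p" "p \<le> 1" "0 \<le> q" "q \<le> 1"
  shows "expected_rise (two_point p a b) (two_point q c d) =
    p * (q * max 0 (c - a) + (1 - q) * max 0 (d - a))
      + (1 - p) * (q * max 0 (c - b) + (1 - q) * max 0 (d - b))"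
  using assms unfolding expected_rise_def by (simp add: integral_two_point)

lemma expected_discount_two_point:
  assumes "0 \<le> p" "p \<le> 1" "0 \<le> q" "q \<le> 1"
  shows "expected_discount (two_point p a b) (two_point q c d) =
    p * max 0 (q * c + (1 - q) * d - a) + (1 - p) * max 0 (q * c + (1 - q) * d - b)"
  using assms unfolding expected_discount_def by (simp add: integral_two_point)

text \<open>The mean rises from \<open>1 - \<epsilon>\<close> to \<open>1\<close> and falls back in every period, and only the rise is
  worth \<open>\<epsilon>\<close> to the trader.  Each of the two deviations of the prices from their means is
  worth another \<open>\<epsilon>\<close> to the prophet, up to terms of order \<open>\<epsilon>\<^sup>2\<close>.\<close>

lemma not_competitive_all_markets:
  assumes A: "online_algorithm all_markets A" and \<alpha>: "0 \<le> \<alpha>" "\<alpha> < 3"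
  shows "\<not> competitive all_markets A \<alpha>"
proof -
  \<comment> \<open>The ratio found below is 3 - 4\<epsilon> + 2\<epsilon>^2. It exceeds 3 -
    6\<epsilon>, which this choice makes equal to \<alpha>.\<close>
  define \<epsilon> where "\<epsilon> = (3 - \<alpha>) / 6"
  have \<epsilon>: "0 < \<epsilon>" "\<epsilon> < 1" "\<alpha> = 3 - 6 * \<epsilon>"
    using \<alpha> by (auto simp: \<epsilon>_def field_simps)
  let ?P = "two_point \<epsilon> 0 1" and ?Q = "two_point \<epsilon> (2 - \<epsilon>) (1 - \<epsilon>)"
  have valid: "valid_market (alternating_market ?P ?Q n)" if "0 < n" for n
    using that \<epsilon> by (intro valid_market_alternating_two_point) auto
  have mean: "\<epsilon> * (2 - \<epsilon>) + (1 - \<epsilon>) * (1 - \<epsilon>) = 1"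
    by (simp add: algebra_simps)
  \<comment> \<open>From \<open>?P\<close> the trader gains only at price 0, with probability
    \<epsilon> and gain 1. From \<open>?Q\<close> it gains nothing, as no \<open>?Q\<close>-price
    lies below the mean 1 - \<epsilon> of \<open>?P\<close>.\<close>
  have "expected_discount ?P ?Q + expected_discount ?Q ?P = \<epsilon>"
    using \<epsilon> mean by (simp add: expected_discount_two_point)
  \<comment> \<open>The period to \<open>?Q\<close> gives \<epsilon> + \<epsilon>(1 - \<epsilon>)^2,
    the period back gives \<epsilon>(1 - \<epsilon>)^2.\<close>
  moreover have "expected_rise ?P ?Q + expected_rise ?Q ?P = \<epsilon> * (1 + 2 * (1 - \<epsilon>)\<^sup>2)"
    using \<epsilon> mean by (simp add: expected_rise_two_point power2_eq_square algebra_simps)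
  moreover have "\<alpha> * \<epsilon> < \<epsilon> * (1 + 2 * (1 - \<epsilon>)\<^sup>2)"
  proof -
    have "1 + 2 * (1 - \<epsilon>)\<^sup>2 = \<alpha> + 2 * \<epsilon> + 2 * \<epsilon>\<^sup>2"
      by (simp add: \<epsilon>(3) power2_eq_square algebra_simps)
    then have "\<alpha> < 1 + 2 * (1 - \<epsilon>)\<^sup>2"
      using \<epsilon>(1) zero_le_power2[of \<epsilon>] by linarith
    then show ?thesis
      using \<epsilon> by (simp add: mult.commute[of \<alpha>])
  qed
  ultimately show ?thesis
    using \<epsilon> valid
    by (intro not_competitive_alternating_market[OF A \<alpha>(1), of ?P ?Q])
      (auto simp: all_markets_def integral_two_point)
qed

text \<open>A fair price on 0 and 2\<mu> alternates with the constant \<mu>. Stepping to the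
  constant is worth \<mu>/2 to both players, stepping away from it \<mu>/2 to the prophet only; the
  ratio per pair of periods is exactly 2.\<close>

lemma not_competitive_equal_mean_markets:
  assumes A: "online_algorithm (equal_mean_markets \<mu>) A" and \<alpha>: "0 \<le> \<alpha>" "\<alpha> < 2" and \<mu>: "0 < \<mu>"
  shows "\<not> competitive (equal_mean_markets \<mu>) A \<alpha>"
proof -
  let ?P = "two_point (1 / 2) 0 (2 * \<mu>)" and ?Q = "two_point 1 \<mu> \<mu>"
  have valid: "valid_market (alternating_market ?P ?Q n)" if "0 < n" for n
    using that \<mu> by (intro valid_market_alternating_two_point) auto
  have "mean_price (alternating_market ?P ?Q n) i = \<mu>" if "i \<in> {1..2 * n}" for i n
    using that price_dist_alternating_market[of "i - 1" n ?P ?Q]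
    by (auto simp: mean_price_def integral_two_point)
  then have "alternating_market ?P ?Q n \<in> equal_mean_markets \<mu>" if "0 < n" for n
    using that valid by (auto simp: equal_mean_markets_def)
  moreover have "\<alpha> * (expected_discount ?P ?Q + expected_discount ?Q ?P)
      < expected_rise ?P ?Q + expected_rise ?Q ?P"
  proof -
    have "expected_discount ?P ?Q + expected_discount ?Q ?P = \<mu> / 2"
      "expected_rise ?P ?Q + expected_rise ?Q ?P = \<mu>"
      using \<mu> by (simp_all add: expected_discount_two_point expected_rise_two_point)
    then show ?thesis
      using \<mu> \<alpha> by (simp only:) simp
  qed
  ultimately show ?thesis
    using \<mu> valid
    by (intro not_competitive_alternating_market[OF A \<alpha>(1), of ?P ?Q])
      (simp_all add: integral_two_point)
qed

theorem theorem1: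
  shows "competitive all_markets buy_low_sell_high 3
    \<and> competitive (\<Union>\<mu>. equal_mean_markets \<mu>) buy_low_sell_high 2
    \<and> (\<forall>(A :: 'r algorithm) \<alpha>.
          online_algorithm all_markets A \<and> 0 \<le> \<alpha> \<and> \<alpha> < 3
            \<longrightarrow> \<not> competitive all_markets A \<alpha>)
    \<and> (\<forall>(A :: 'r algorithm) \<alpha>. \<forall>\<mu>>0.
          online_algorithm (equal_mean_markets \<mu>) A \<and> 0 \<le> \<alpha> \<and> \<alpha> < 2
            \<longrightarrow> \<not> competitive (equal_mean_markets \<mu>) A \<alpha>)"
  using competitive_buy_low_sell_high_3 competitive_buy_low_sell_high_2
    not_competitive_all_markets not_competitive_equal_mean_markets by blast

end
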